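(* Let $f:\mathbb{R}^d\to\mathbb{R}$ be locally Lipschitz with optimal value $f^\ast$ and nonempty set of minimizers $\mathcal{X}_\ast$, let $\bar x\in\mathcal{X}_\ast$ and $\delta>0$, and suppose the sharpness assumption (with constant $\mu>0$) and the $(b)$-regularity assumption (with generalized gradient mapping $g$ and constants $C_{(b)},\eta>0$) stated in the context hold at $\bar x$. Let $L$ be an upper bound for the norms of all elements of $g(B_\delta(\bar x))=\bigcup_{x\in B_\delta(\bar x)}g(x)$ and also a Lipschitz constant of $f$ on $B_\delta(\bar x)$. Then there exists a constant $C_{\mathsf s}>0$ such that for all scalars $\tau>3/\mu$ and all points $x\in\mathbb{R}^d$ with $$\|x-\bar x\|<\frac{\delta}{4}\qquad\text{and}\qquad \mathrm{dist}(x,\mathcal{X}_\ast)\le\min\left\{\left(\frac{\mu}{2C_{(b)}}\right)^{1/\eta},\left(\frac{\mu^{1-\eta}}{L\,C_{\mathsf s}}\right)^{1/\eta}\right\},$$ every run of the procedure $\mathtt{PolyakBundle}(x,\tau)$ (i.e. for every choice of the vectors $v_i$) returns a point $\tilde x$ satisfying $$f(\tilde x)-f^\ast\le C_{\mathsf s}\,(f(x)-f^\ast)^{1+\eta}.$$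
   Context: $\|\cdot\|$ is the Euclidean norm, $B_r(x)$ is the open ball, $\mathrm{dist}(x,\mathcal{X})=\inf_{y\in\mathcal{X}}\|x-y\|$, and $A^\dagger$ is the Moore–Penrose pseudoinverse. Here $f^\ast=\min f$ and $\mathcal{X}_\ast=\operatorname{argmin} f\neq\emptyset$. Sharpness assumption: $f(x)-f^\ast\ge\mu\,\mathrm{dist}(x,\mathcal{X}_\ast)$ for all $x\in B_\delta(\bar x)$. $(b)$-regularity assumption: $g$ assigns to each $x\in\mathbb{R}^d$ a nonempty set $g(x)\subseteq\mathbb{R}^d$, is locally bounded (images of bounded sets are bounded), and $$|f(x)+\langle v,y-x\rangle-f^\ast|\le C_{(b)}\|y-x\|^{1+\eta}$$ for all $x\in B_\delta(\bar x)$, $v\in g(x)$, and $y\in\mathcal{X}_\ast\cap B_{2\delta}(\bar x)$. Procedure $\mathtt{PolyakBundle}(x,\tau)$: set $y_0=x$ and choose any $v_0\in g(y_0)$. For $i=1,\dots,d$: let $A_i\in\mathbb{R}^{i\times d}$ be the matrix with rows $v_0^T,\dots,v_{i-1}^T$, set $$y_i=y_0-A_i^\dagger\big[f(y_j)-f^\ast+\langle v_j,y_0-y_j\rangle\big]_{j=0}^{i-1},$$ and choose any $v_i\in g(y_i)$. Return $y_s$, where $s$ minimizes $f(y_i)$ over those $i\in\{1,\dots,d\}$ with $\|y_i-y_0\|\le\tau(f(y_0)-f^\ast)$ (the output is $\emptyset$ if there is no such $i$). *)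

theory Defs
  imports "HOL-Analysis.Analysis" "Jordan_Normal_Form.Matrix"
begin

no_notation Matrix.vec_index (infixl \<open>$\<close> 100)
no_notation Matrix.scalar_prod (infix \<open>\<bullet>\<close> 70)

definition min_value :: "('a \<Rightarrow> real) \<Rightarrow> real" where
  "min_value f = (INF x. f x)"

definition minimizers :: "('a \<Rightarrow> real) \<Rightarrow> 'a set" where
  "minimizers f = {x. is_arg_min f (\<lambda>_. True) x}"

definition locally_lipschitz :: "('a::metric_space \<Rightarrow> real) \<Rightarrow> bool" where
  "locally_lipschitz f \<longleftrightarrow> (\<forall>x. \<exists>r>0. \<exists>K. K-lipschitz_on (ball x r) f)"

definition sharp_at :: "('a::euclidean_space \<Rightarrow> real) \<Rightarrow> real \<Rightarrow> real \<Rightarrow> 'a \<Rightarrow> bool" where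
  "sharp_at f \<mu> \<delta> xbar \<longleftrightarrow>
     (\<forall>x\<in>ball xbar \<delta>. f x - min_value f \<ge> \<mu> * infdist x (minimizers f))"

definition b_regular_at ::
  "('a::euclidean_space \<Rightarrow> real) \<Rightarrow> ('a \<Rightarrow> 'a set) \<Rightarrow> real \<Rightarrow> real \<Rightarrow> real \<Rightarrow> 'a \<Rightarrow> bool" where
  "b_regular_at f g C \<eta> \<delta> xbar \<longleftrightarrow>
     (\<forall>x. g x \<noteq> {}) \<and>
     (\<forall>S. bounded S \<longrightarrow> bounded (\<Union>x\<in>S. g x)) \<and>
     (\<forall>x\<in>ball xbar \<delta>. \<forall>v\<in>g x. \<forall>y\<in>minimizers f \<inter> ball xbar (2 * \<delta>).
        \<bar>f x + v \<bullet> (y - x) - min_value f\<bar> \<le> C * norm (y - x) powr (1 + \<eta>))"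

text \<open>The Moore--Penrose pseudoinverse: the unique solution of the four Penrose equations.\<close>

definition pseudoinverse :: "real mat \<Rightarrow> real mat" where
  "pseudoinverse A = (THE X. X \<in> carrier_mat (dim_col A) (dim_row A) \<and>
     A * X * A = A \<and> X * A * X = X \<and>
     transpose_mat (A * X) = A * X \<and> transpose_mat (X * A) = X * A)"

text \<open>The matrices of the bundle procedure have a varying number of rows, so they are matrices with
  explicit dimensions. Points of \<open>real ^ 'n\<close> are passed to them through their coordinate vectors,
  with respect to a fixed enumeration of the finite index type \<open>'n\<close>; the procedure does
  not depend on which enumeration is used.\<close>

definition coords :: "real ^ 'n \<Rightarrow> real Matrix.vec" where
  "coords x = Matrix.vec CARD('n) (\<lambda>k. x $ from_nat_into UNIV k)"

definition bundle_matrix :: "(nat \<Rightarrow> real ^ 'n) \<Rightarrow> nat \<Rightarrow> real mat" where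
  "bundle_matrix v i = mat_of_rows CARD('n) (map (\<lambda>j. coords (v j)) [0..<i])"

definition bundle_residual ::
  "(real ^ 'n \<Rightarrow> real) \<Rightarrow> (nat \<Rightarrow> real ^ 'n) \<Rightarrow> (nat \<Rightarrow> real ^ 'n) \<Rightarrow> nat \<Rightarrow> real Matrix.vec" where
  "bundle_residual f y v i =
     Matrix.vec i (\<lambda>j. f (y j) - min_value f + v j \<bullet> (y 0 - y j))"

definition bundle_iterates ::
  "(real ^ 'n \<Rightarrow> real) \<Rightarrow> (real ^ 'n \<Rightarrow> (real ^ 'n) set) \<Rightarrow> real ^ 'n \<Rightarrow>
     (nat \<Rightarrow> real ^ 'n) \<Rightarrow> (nat \<Rightarrow> real ^ 'n) \<Rightarrow> bool" where
  "bundle_iterates f g x y v \<longleftrightarrow>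
     y 0 = x \<and> v 0 \<in> g (y 0) \<and>
     (\<forall>i\<in>{1..CARD('n)}.
        coords (y i) = coords (y 0) - pseudoinverse (bundle_matrix v i) *\<^sub>v bundle_residual f y v i \<and>
        v i \<in> g (y i))"

definition bundle_candidates ::
  "(real ^ 'n \<Rightarrow> real) \<Rightarrow> real \<Rightarrow> (nat \<Rightarrow> real ^ 'n) \<Rightarrow> nat set" where
  "bundle_candidates f \<tau> y =
     {i \<in> {1..CARD('n)}. norm (y i - y 0) \<le> \<tau> * (f (y 0) - min_value f)}"

text \<open>The set of outputs of all runs, over all choices of the \<open>v i\<close> and of the minimizing
  index \<open>s\<close>; the empty output is \<open>None\<close>.\<close>

definition polyak_bundle ::
  "(real ^ 'n \<Rightarrow> real) \<Rightarrow> (real ^ 'n \<Rightarrow> (real ^ 'n) set) \<Rightarrow> real ^ 'n \<Rightarrow> real \<Rightarrow>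
     (real ^ 'n) option set" where
  "polyak_bundle f g x \<tau> = {out. \<exists>y v. bundle_iterates f g x y v \<and>
     (if bundle_candidates f \<tau> y = {} then out = None
      else \<exists>s. is_arg_min (\<lambda>i. f (y i)) (\<lambda>i. i \<in> bundle_candidates f \<tau> y) s \<and> out = Some (y s))}"

end

theory Submission
  imports Defs "Jordan_Normal_Form.Determinant"
begin

text \<open>
  Write \<open>gap z = f z - min_value f\<close>, let \<open>D\<close> be the distance from \<open>x\<close> to the minimizers, and let
  \<open>y i\<close>, \<open>v i\<close> be the points and vectors of one run. The idea is that every bundle step
  either makes superlinear progress or adds a vector that is quantitatively independent of the
  previous ones; in dimension \<open>d\<close> the second case cannot happen for all of \<open>v 0, \<dots>, v d\<close>.

  Independence is measured by \<open>interpolates v i K\<close>: prescribed values of \<open>v 0, \<dots>, v (i - 1)\<close>, bounded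
  by \<open>M\<close>, are attained at a vector of norm at most \<open>K * M\<close>. As long as this holds, the
  pseudoinverse step moves \<open>y 0\<close> to the nearest point \<open>y i\<close> at which all the linear models
  \<open>\<lambda>z. gap (y j) + v j \<bullet> (z - y j)\<close>, \<open>j < i\<close>, vanish (\<open>pseudoinverse_step_least_norm\<close>).
  By regularity these models have size \<open>D powr (1 + \<eta>)\<close> at minimizers near \<open>x\<close>, up to a constant.
  A minimizer nearest to \<open>x\<close> is therefore close to a common zero of the models, so that
  \<open>norm (y i - y 0) \<le> 2 * D\<close> (\<open>bundle_step_near\<close>). Since \<open>\<mu> * D \<le> gap x\<close> and \<open>\<tau> > 3 / \<mu>\<close>, the index \<open>i\<close> is a
  candidate for the output.

  Now let \<open>p\<close> be a minimizer nearest to \<open>y i\<close> and let \<open>u\<close> be the unit vector from \<open>p\<close> to \<open>y i\<close>.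
  Sharpness and regularity at \<open>y i\<close> give \<open>v i \<bullet> u \<ge> \<mu> / 2\<close>. For \<open>j < i\<close> the \<open>j\<close>-th model vanishes at \<open>y i\<close> and
  is of order \<open>D powr (1 + \<eta>)\<close> at \<open>p\<close>, so \<open>\<bar>v j \<bullet> u\<bar>\<close> is of order \<open>D powr (1 + \<eta>) / norm (y i - p)\<close>.
  If \<open>gap (y i)\<close> exceeds \<open>C_s * gap x powr (1 + \<eta>)\<close>, then \<open>norm (y i - p)\<close> is at least a multiple of
  \<open>C_s * D powr (1 + \<eta>)\<close>, and \<open>\<bar>v j \<bullet> u\<bar>\<close> is as small as desired once \<open>C_s\<close> is large
  (\<open>new_direction\<close>). Hence \<open>u\<close> is almost orthogonal to the old vectors but not to the new
  one, and \<open>v 0, \<dots>, v i\<close> interpolate with a larger constant that depends only on \<open>L\<close>, \<open>\<mu>\<close> and \<open>i\<close>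
  (\<open>interpolates_Suc\<close>). If no step made superlinear progress, \<open>d + 1\<close> vectors would interpolate,
  which is impossible (\<open>interpolates_le_DIM\<close>).

  If \<open>D = 0\<close>, this argument has no direction \<open>u\<close> to start from, but the first step then does not move and
  returns the minimizer \<open>x\<close> as a candidate.
\<close>

no_notation Matrix.vec_index (infixl \<open>$\<close> 100)
no_notation Matrix.scalar_prod (infix \<open>\<bullet>\<close> 70)

section \<open>The pseudoinverse of a matrix with independent rows\<close>

text \<open>Uniqueness in the Penrose equations: two solutions \<open>X\<close> and \<open>Y\<close> satisfy \<open>A * X = A * Y\<close> and
  \<open>X * A = Y * A\<close>, because these products are symmetric idempotents with the same range, respectively the
  same kernel.\<close>

lemma pseudoinverse_eqI:
  assumes A: "A \<in> carrier_mat m n" and X: "X \<in> carrier_mat n m"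
    and "A * X * A = A" "X * A * X = X"
    and "transpose_mat (A * X) = A * X" "transpose_mat (X * A) = X * A"
  shows "pseudoinverse A = X"
  unfolding pseudoinverse_def
proof (rule the_equality)
  show "X \<in> carrier_mat (dim_col A) (dim_row A) \<and> A * X * A = A \<and> X * A * X = X \<and>
     transpose_mat (A * X) = A * X \<and> transpose_mat (X * A) = X * A"
    using assms by auto
next
  fix Y
  assume "Y \<in> carrier_mat (dim_col A) (dim_row A) \<and> A * Y * A = A \<and> Y * A * Y = Y \<and>
     transpose_mat (A * Y) = A * Y \<and> transpose_mat (Y * A) = Y * A"
  then have Y: "Y \<in> carrier_mat n m" and AYA: "A * Y * A = A" and YAY: "Y * A * Y = Y"
    and AYt: "transpose_mat (A * Y) = A * Y" and YAt: "transpose_mat (Y * A) = Y * A"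
    using A by auto
  have AX: "A * X \<in> carrier_mat m m" and AY: "A * Y \<in> carrier_mat m m"
    and XA: "X * A \<in> carrier_mat n n" and YA: "Y * A \<in> carrier_mat n n"
    using A X Y by auto
  have "A * X = (A * Y) * (A * X)"
    using AYA assoc_mult_mat[OF AY A X] by simp
  also have "\<dots> = transpose_mat ((A * X) * (A * Y))"
    using transpose_mult[OF AX AY] assms(5) AYt by simp
  also have "(A * X) * (A * Y) = A * Y"
    using assms(3) assoc_mult_mat[OF AX A Y] by simp
  finally have eqA: "A * X = A * Y" using AYt by simp
  have "X * A = (X * A) * (Y * A)"
    using AYA assoc_mult_mat[OF XA Y A] assoc_mult_mat[OF X A Y] assoc_mult_mat[OF X AY A] by simp
  also have "\<dots> = transpose_mat ((Y * A) * (X * A))"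
    using transpose_mult[OF YA XA] assms(6) YAt by simp
  also have "(Y * A) * (X * A) = Y * A"
    using assms(3) assoc_mult_mat[OF YA X A] assoc_mult_mat[OF Y A X] assoc_mult_mat[OF Y AX A]
    by simp
  finally have eqB: "X * A = Y * A" using YAt by simp
  have "Y = Y * A * Y" by (rule YAY[symmetric])
  also have "\<dots> = X * A * Y" using eqB by simp
  also have "\<dots> = X * A * X" using eqA assoc_mult_mat[OF X A Y] assoc_mult_mat[OF X A X] by simp
  also have "\<dots> = X" by (rule assms(4))
  finally show "Y = X" .
qed

lemma pseudoinverse_zero: "pseudoinverse (0\<^sub>m m n) = 0\<^sub>m n m"
  by (rule pseudoinverse_eqI[of _ m n]) auto

lemma pseudoinverse_right_invertible_Gram:
  assumes A: "A \<in> carrier_mat m n" and B: "B \<in> carrier_mat m m"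
    and inv: "(A * transpose_mat A) * B = 1\<^sub>m m"
  shows "pseudoinverse A = transpose_mat A * B"
proof -
  let ?T = "transpose_mat A"
  have T: "?T \<in> carrier_mat n m" using A by simp
  have G: "A * ?T \<in> carrier_mat m m" using A by simp
  have Gt: "transpose_mat (A * ?T) = A * ?T"
    using transpose_mult[OF A T] by simp
  have Bt: "transpose_mat B \<in> carrier_mat m m" using B by simp
  have "transpose_mat B * (A * ?T) = 1\<^sub>m m"
    using transpose_mult[OF G B] inv Gt by (metis transpose_one)
  \<comment> \<open>The transpose of \<open>B\<close> is a left inverse of the Gram matrix, hence equal to the right inverse \<open>B\<close>.\<close>
  then have Bsym: "transpose_mat B = B"
    using assoc_mult_mat[OF Bt G B] inv B Bt by simp
  have X: "?T * B \<in> carrier_mat n m" using T B by simp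
  have AX: "A * (?T * B) = 1\<^sub>m m" using inv assoc_mult_mat[OF A T B] by simp
  have BA: "B * A \<in> carrier_mat m n" using A B by simp
  have "transpose_mat (?T * B * A) = ?T * (transpose_mat B * A)"
    using transpose_mult[OF X A] transpose_mult[OF T B] assoc_mult_mat[OF T Bt A]
      assoc_mult_mat[OF T B A] Bsym by simp
  then have "transpose_mat (?T * B * A) = ?T * B * A"
    using Bsym assoc_mult_mat[OF T B A] by simp
  moreover have "?T * B * A * (?T * B) = ?T * B"
    unfolding assoc_mult_mat[OF X A X] AX by (rule right_mult_one_mat[OF X])
  ultimately show ?thesis
    by (intro pseudoinverse_eqI[OF A X]) (use AX A in simp_all)
qed

section \<open>Well-conditioned families of vectors\<close>

text \<open>Equivalently, the linear map \<open>w \<mapsto> (v j \<bullet> w)\<^sub>j\<close> into \<open>i\<close>-tuples is onto and has a right inverse of norm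
  at most \<open>K\<close> with respect to the maximum norm. In this form both uses are immediate: correcting
  small errors by a small vector, and adding one more vector to the family.\<close>

definition interpolates :: "(nat \<Rightarrow> 'a::real_inner) \<Rightarrow> nat \<Rightarrow> real \<Rightarrow> bool" where
  "interpolates v i K \<longleftrightarrow> (\<forall>b M. 0 \<le> M \<longrightarrow> (\<forall>j<i. \<bar>b j\<bar> \<le> M) \<longrightarrow>
     (\<exists>w. (\<forall>j<i. v j \<bullet> w = b j) \<and> norm w \<le> K * M))"

lemma interpolatesE:
  assumes "interpolates v i K" "0 \<le> M" "\<And>j. j < i \<Longrightarrow> \<bar>b j\<bar> \<le> M"
  obtains w where "\<And>j. j < i \<Longrightarrow> v j \<bullet> w = b j" "norm w \<le> K * M"
  using assms unfolding interpolates_def by blast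

lemma interpolates_0: "interpolates v 0 K" if "0 \<le> K"
  unfolding interpolates_def using that by (auto intro!: exI[of _ 0])

lemma interpolates_mono: "interpolates v i K \<Longrightarrow> K \<le> K' \<Longrightarrow> interpolates v i K'"
  unfolding interpolates_def by (meson mult_right_mono order_trans)

lemma interpolates_surj:
  assumes "interpolates v i K"
  obtains w where "\<And>j. j < i \<Longrightarrow> v j \<bullet> w = b j"
proof -
  have "0 \<le> (\<Sum>k<i. \<bar>b k\<bar>)" by (intro sum_nonneg) simp
  moreover have "\<bar>b j\<bar> \<le> (\<Sum>k<i. \<bar>b k\<bar>)" if "j < i" for j
    using that by (intro member_le_sum) auto
  ultimately obtain w where "\<And>j. j < i \<Longrightarrow> v j \<bullet> w = b j"
    by (rule interpolatesE[OF assms, of "\<Sum>k<i. \<bar>b k\<bar>" b]) blast+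
  then show ?thesis by (rule that)
qed

text \<open>Subtracting from \<open>u\<close> a small vector with the same values of \<open>v j\<close>, \<open>j < i\<close>, gives a vector \<open>h\<close>
  orthogonal to these \<open>v j\<close> with \<open>v i \<bullet> h \<ge> \<mu> / 4\<close> and \<open>norm h \<le> 2\<close>. A solution for the first \<open>i\<close> values
  is corrected by a multiple of \<open>h\<close>, which adjusts the last value and leaves the others alone.\<close>

lemma interpolates_Suc:
  assumes int: "interpolates v i K" and K: "0 \<le> K" and \<mu>: "0 < \<mu>"
    and vi: "norm (v i) \<le> L" and u: "norm u \<le> 1" and viu: "\<mu> / 2 \<le> v i \<bullet> u"
    and vju: "\<And>j. j < i \<Longrightarrow> \<bar>v j \<bullet> u\<bar> \<le> \<epsilon>" and \<epsilon>: "0 \<le> \<epsilon>"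
    and small: "K * \<epsilon> \<le> 1" "L * (K * \<epsilon>) \<le> \<mu> / 4"
  shows "interpolates v (Suc i) (K + 8 * (1 + L * K) / \<mu>)"
  unfolding interpolates_def
proof (intro allI impI)
  fix b :: "nat \<Rightarrow> real" and M :: real
  assume M: "0 \<le> M" and b: "\<forall>j<Suc i. \<bar>b j\<bar> \<le> M"
  have L: "0 \<le> L" using vi norm_ge_zero order_trans by blast
  obtain w0 where w0: "\<And>j. j < i \<Longrightarrow> v j \<bullet> w0 = v j \<bullet> u" "norm w0 \<le> K * \<epsilon>"
    using interpolatesE[OF int \<epsilon>, of "\<lambda>j. v j \<bullet> u"] vju by blast
  define h where "h = u - w0"
  have h0: "v j \<bullet> h = 0" if "j < i" for j
    using w0(1)[OF that] by (simp add: h_def inner_diff_right)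
  have hn: "norm h \<le> 2"
    unfolding h_def using norm_triangle_ineq4[of u w0] u w0(2) small(1) by linarith
  have "v i \<bullet> w0 \<le> norm (v i) * norm w0" by (rule norm_cauchy_schwarz)
  also have "\<dots> \<le> L * (K * \<epsilon>)" using vi w0(2) L by (intro mult_mono) auto
  finally have hi: "\<mu> / 4 \<le> v i \<bullet> h"
    using viu small(2) by (simp add: h_def inner_diff_right)
  obtain w1 where w1: "\<And>j. j < i \<Longrightarrow> v j \<bullet> w1 = b j" "norm w1 \<le> K * M"
    using interpolatesE[OF int M, of b] b by auto
  define t where "t = (b i - v i \<bullet> w1) / (v i \<bullet> h)"
  have "\<bar>v i \<bullet> w1\<bar> \<le> norm (v i) * norm w1" by (rule Cauchy_Schwarz_ineq2)
  also have "\<dots> \<le> L * (K * M)" using vi w1(2) L by (intro mult_mono) auto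
  finally have num: "\<bar>b i - v i \<bullet> w1\<bar> \<le> M + L * (K * M)" using b by (smt (verit) lessI)
  have "\<bar>t\<bar> \<le> (M + L * (K * M)) / (\<mu> / 4)"
    unfolding t_def abs_divide using num hi \<mu> by (intro frac_le) auto
  also have "\<dots> = 4 * (1 + L * K) / \<mu> * M" by (simp add: field_simps)
  finally have t: "\<bar>t\<bar> \<le> 4 * (1 + L * K) / \<mu> * M" .
  have "norm (w1 + t *\<^sub>R h) \<le> norm w1 + \<bar>t\<bar> * norm h"
    using norm_triangle_ineq[of w1 "t *\<^sub>R h"] by simp
  also have "\<dots> \<le> K * M + (4 * (1 + L * K) / \<mu> * M) * 2"
    using w1(2) t hn by (intro add_mono mult_mono) auto
  also have "\<dots> = (K + 8 * (1 + L * K) / \<mu>) * M" by (simp add: field_simps)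
  finally have "norm (w1 + t *\<^sub>R h) \<le> (K + 8 * (1 + L * K) / \<mu>) * M" .
  moreover have "v j \<bullet> (w1 + t *\<^sub>R h) = b j" if "j < Suc i" for j
  proof (cases "j = i")
    case True
    then show ?thesis using hi \<mu> by (simp add: inner_add_right t_def)
  next
    case False
    then show ?thesis using that h0 w1(1) by (simp add: inner_add_right)
  qed
  ultimately show "\<exists>w. (\<forall>j<Suc i. v j \<bullet> w = b j) \<and>
      norm w \<le> (K + 8 * (1 + L * K) / \<mu>) * M" by blast
qed

text \<open>Interpolation provides a dual family, so the \<open>v j\<close> are linearly independent.\<close>

lemma interpolates_le_DIM:
  fixes v :: "nat \<Rightarrow> 'a::euclidean_space"
  assumes int: "interpolates v i K"
  shows "i \<le> DIM('a)"
proof -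
  have dual: "\<exists>w. \<forall>l<i. v l \<bullet> w = (if l = j then 1 else 0)" for j
    by (rule interpolates_surj[OF int, of "\<lambda>l. if l = j then 1 else 0"]) blast
  have inj: "inj_on v {..<i}"
  proof (rule inj_onI)
    fix j k assume j: "j \<in> {..<i}" and k: "k \<in> {..<i}" and eq: "v j = v k"
    obtain w where w: "\<forall>l<i. v l \<bullet> w = (if l = j then 1 else 0)"
      using dual by blast
    have "(if k = j then 1 else 0) = v k \<bullet> w" using w k by simp
    also have "\<dots> = v j \<bullet> w" by (simp only: eq)
    also have "\<dots> = 1" using w j by simp
    finally show "j = k" by (metis zero_neq_one)
  qed
  have "independent (v ` {..<i})"
  proof (rule independent_if_scalars_zero)
    fix c x assume s: "(\<Sum>x\<in>v ` {..<i}. c x *\<^sub>R x) = 0" and "x \<in> v ` {..<i}"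
    then obtain j where j: "j < i" and x: "x = v j" by blast
    obtain w where w: "\<forall>l<i. v l \<bullet> w = (if l = j then 1 else 0)"
      using dual by blast
    have "(\<Sum>l<i. c (v l) *\<^sub>R v l) = 0"
      using s by (simp only: sum.reindex[OF inj] o_def)
    then have "0 = (\<Sum>l<i. c (v l) *\<^sub>R v l) \<bullet> w" by (simp only: inner_zero_left)
    also have "\<dots> = (\<Sum>l<i. if l = j then c (v l) else 0)"
      unfolding inner_sum_left by (intro sum.cong) (simp_all add: w)
    also have "\<dots> = c (v j)" using j by (simp only: sum.delta finite_lessThan lessThan_iff if_True)
    finally show "c x = 0" unfolding x by (rule sym)
  qed (rule finite_imageI, rule finite_lessThan)
  then have "card (v ` {..<i}) \<le> DIM('a)" by (rule independent_card_le)
  then show ?thesis by (simp only: card_image[OF inj] card_lessThan)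
qed

section \<open>The bundle step as a least-norm solution\<close>

definition least_norm_solution :: "(nat \<Rightarrow> 'a::real_inner) \<Rightarrow> nat \<Rightarrow> (nat \<Rightarrow> real) \<Rightarrow> 'a \<Rightarrow> bool" where
  "least_norm_solution v i b z \<longleftrightarrow> (\<forall>j<i. v j \<bullet> z = b j) \<and>
     (\<forall>w. (\<forall>j<i. v j \<bullet> w = b j) \<longrightarrow> norm z \<le> norm w)"

lemma dim_coords [simp]: "dim_vec (coords (x :: real ^ 'n)) = CARD('n)"
  by (simp add: coords_def)

lemma coords_carrier [simp]: "coords (x :: real ^ 'n) \<in> carrier_vec CARD('n)"
  by (simp add: coords_def)

lemma coords_diff: "coords (x - y) = coords x - coords (y :: real ^ 'n)"
  by (intro eq_vecI) (auto simp: coords_def)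

lemma coords_index_sum:
  "(\<Sum>k<CARD('n). h (from_nat_into (UNIV :: 'n set) k)) = (\<Sum>i\<in>(UNIV :: 'n::finite set). h i)"
  using bij_betw_from_nat_into_finite[of "UNIV :: 'n set"]
  by (intro sum.reindex_bij_betw) simp

lemma scalar_prod_coords: "scalar_prod (coords x) (coords y) = x \<bullet> (y :: real ^ 'n)"
  using coords_index_sum[of "\<lambda>i. x $ i * y $ i"]
  by (simp add: scalar_prod_def coords_def inner_vec_def lessThan_atLeast0)

lemma coords_inject:
  assumes "coords x = coords y"
  shows "x = (y :: real ^ 'n)"
proof -
  have "coords (x - y) = 0\<^sub>v CARD('n)"
    unfolding coords_diff assms by (rule minus_cancel_vec[OF coords_carrier])
  then have "(x - y) \<bullet> (x - y) = 0"
    unfolding scalar_prod_coords[symmetric] by simp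
  then show ?thesis by simp
qed

lemma bundle_matrix_carrier [simp]:
  "bundle_matrix (v :: nat \<Rightarrow> real ^ 'n) i \<in> carrier_mat i CARD('n)"
  by (simp add: bundle_matrix_def mat_of_rows_def)

lemma bundle_matrix_mult_coords:
  "bundle_matrix v i *\<^sub>v coords w = Matrix.vec i (\<lambda>j. v j \<bullet> (w :: real ^ 'n))"
  by (intro eq_vecI) (auto simp: bundle_matrix_def scalar_prod_coords)

lemma scalar_prod_self_eq_0:
  fixes x :: "real Matrix.vec"
  assumes "x \<in> carrier_vec n" "scalar_prod x x = 0"
  shows "x = 0\<^sub>v n"
proof (rule eq_vecI)
  fix k assume k: "k < dim_vec (0\<^sub>v n :: real Matrix.vec)"
  have "\<forall>k\<in>{0..<dim_vec x}. vec_index x k * vec_index x k = 0"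
    using assms(2) unfolding scalar_prod_def by (subst (asm) sum_nonneg_eq_0_iff) auto
  then show "vec_index x k = vec_index (0\<^sub>v n) k" using k assms(1) by auto
qed (use assms in auto)

text \<open>A vector \<open>c\<close> in the kernel of the Gram matrix is annihilated by the transpose of \<open>bundle_matrix v i\<close>,
  that is, orthogonal to the range of \<open>bundle_matrix v i\<close>; by interpolation this range contains \<open>c\<close>.\<close>

lemma bundle_Gram_invertible:
  fixes v :: "nat \<Rightarrow> real ^ 'n"
  assumes int: "interpolates v i K"
  obtains B where "B \<in> carrier_mat i i"
    "bundle_matrix v i * transpose_mat (bundle_matrix v i) * B = 1\<^sub>m i"
proof -
  let ?A = "bundle_matrix v i"
  let ?T = "transpose_mat ?A"
  have A: "?A \<in> carrier_mat i CARD('n)" by simp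
  have T: "?T \<in> carrier_mat CARD('n) i" by simp
  have G: "?A * ?T \<in> carrier_mat i i" using A T by (rule mult_carrier_mat)
  have "c = 0\<^sub>v i" if c: "c \<in> carrier_vec i" and Gc: "?A * ?T *\<^sub>v c = 0\<^sub>v i" for c
  proof -
    have Tc: "?T *\<^sub>v c \<in> carrier_vec CARD('n)" using T c by (rule mult_mat_vec_carrier)
    have "scalar_prod (?T *\<^sub>v c) (?T *\<^sub>v c) = scalar_prod c (?A *\<^sub>v (?T *\<^sub>v c))"
      by (rule transpose_vec_mult_scalar[OF A Tc c])
    also have "?A *\<^sub>v (?T *\<^sub>v c) = 0\<^sub>v i" using Gc assoc_mult_mat_vec[OF A T c] by simp
    finally have "scalar_prod (?T *\<^sub>v c) (?T *\<^sub>v c) = 0" using c by simp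
    then have Tc0: "?T *\<^sub>v c = 0\<^sub>v CARD('n)"
      by (rule scalar_prod_self_eq_0[OF Tc])
    obtain w where w: "\<And>j. j < i \<Longrightarrow> v j \<bullet> w = vec_index c j"
      using interpolates_surj[OF int] by blast
    have "?A *\<^sub>v coords w = c"
      unfolding bundle_matrix_mult_coords using c w by (intro eq_vecI) auto
    then have "scalar_prod c c = scalar_prod (?T *\<^sub>v c) (coords w)"
      using transpose_vec_mult_scalar[OF A coords_carrier c] by simp
    then have "scalar_prod c c = 0" unfolding Tc0 by simp
    then show ?thesis by (rule scalar_prod_self_eq_0[OF c])
  qed
  then have "Determinant.det (?A * ?T) \<noteq> 0"
    using det_0_iff_vec_prod_zero_field[OF G] by blast
  then have "?A * ?T \<in> Units (ring_mat TYPE(real) i ())"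
    by (rule det_non_zero_imp_unit[OF G])
  then show ?thesis using that unfolding Units_def ring_mat_def by auto
qed

text \<open>The step \<open>z = y - y'\<close> is a linear combination of the \<open>v j\<close>, with coefficients \<open>c = B b\<close> where \<open>B\<close>
  inverts the Gram matrix. The inner product of \<open>z\<close> with a vector \<open>p\<close> thus depends only on the values
  \<open>v j \<bullet> p\<close>, so \<open>z \<bullet> w = z \<bullet> z\<close> for every other solution \<open>w\<close>, and Cauchy--Schwarz gives minimality.\<close>

lemma pseudoinverse_step_least_norm:
  fixes v :: "nat \<Rightarrow> real ^ 'n"
  assumes int: "interpolates v i K"
    and step: "coords y' = coords y - pseudoinverse (bundle_matrix v i) *\<^sub>v Matrix.vec i b"
  shows "least_norm_solution v i b (y - y')"
proof -
  let ?A = "bundle_matrix v i"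
  let ?T = "transpose_mat ?A"
  let ?b = "Matrix.vec i b"
  let ?z = "y - y'"
  have A: "?A \<in> carrier_mat i CARD('n)" by simp
  have T: "?T \<in> carrier_mat CARD('n) i" by simp
  obtain B where B: "B \<in> carrier_mat i i" and inv: "?A * ?T * B = 1\<^sub>m i"
    by (rule bundle_Gram_invertible[OF int])
  define c where "c = B *\<^sub>v ?b"
  have b: "?b \<in> carrier_vec i" by simp
  have c: "c \<in> carrier_vec i" using B by (auto simp: c_def)
  have P: "pseudoinverse ?A *\<^sub>v ?b = ?T *\<^sub>v c"
    unfolding pseudoinverse_right_invertible_Gram[OF A B inv] c_def
    by (rule assoc_mult_mat_vec[OF T B b])
  have Tc: "?T *\<^sub>v c \<in> carrier_vec CARD('n)" using T c by (rule mult_mat_vec_carrier)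
  have z: "coords ?z = ?T *\<^sub>v c"
    unfolding coords_diff step P using Tc by (intro eq_vecI) auto
  have "?A *\<^sub>v coords ?z = ?A * ?T * B *\<^sub>v ?b"
    unfolding z using assoc_mult_mat_vec[OF A T c] assoc_mult_mat_vec[OF mult_carrier_mat[OF A T] B b]
    by (simp add: c_def)
  then have Az: "?A *\<^sub>v coords ?z = ?b" unfolding inv by simp
  have zv: "v j \<bullet> ?z = b j" if "j < i" for j
    using arg_cong[OF Az, of "\<lambda>x. vec_index x j"] that
    by (simp add: bundle_matrix_mult_coords)
  have zmin: "norm ?z \<le> norm w" if w: "\<forall>j<i. v j \<bullet> w = b j" for w
  proof -
    have Aw: "?A *\<^sub>v coords w = ?b"
      unfolding bundle_matrix_mult_coords using w by (intro eq_vecI) auto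
    have inner: "?z \<bullet> p = scalar_prod c (?A *\<^sub>v coords p)" for p
      unfolding scalar_prod_coords[symmetric] z
      by (rule transpose_vec_mult_scalar[OF A coords_carrier c])
    have "norm ?z * norm ?z = ?z \<bullet> ?z"
      by (simp only: power2_norm_eq_inner[symmetric] power2_eq_square)
    also have "\<dots> = ?z \<bullet> w" unfolding inner Az Aw ..
    also have "\<dots> \<le> norm ?z * norm w" by (rule norm_cauchy_schwarz)
    finally show ?thesis
      by (smt (verit) mult_less_cancel_left_pos norm_ge_zero)
  qed
  show ?thesis
    unfolding least_norm_solution_def
    by (intro conjI allI impI) (fact zv, erule zmin)
qed

text \<open>Run from a minimizer, the first step has residual zero. The vector \<open>v 0\<close> may then be zero too; in that
  case the pseudoinverse is that of the zero matrix.\<close>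

lemma first_bundle_step_zero_residual:
  fixes v :: "nat \<Rightarrow> real ^ 'n" and y y' :: "real ^ 'n"
  assumes step: "coords y' = coords y - pseudoinverse (bundle_matrix v 1) *\<^sub>v Matrix.vec 1 b"
    and b: "b 0 = 0"
  shows "y' = y"
proof (cases "v 0 = 0")
  case True
  have "bundle_matrix v 1 = 0\<^sub>m 1 CARD('n)"
    using True by (intro eq_matI) (auto simp: bundle_matrix_def mat_of_rows_def coords_def)
  then have "pseudoinverse (bundle_matrix v 1) = 0\<^sub>m CARD('n) 1"
    by (simp only: pseudoinverse_zero)
  then have "coords y' = coords y"
    unfolding step by (intro eq_vecI) auto
  then show ?thesis by (rule coords_inject)
next
  case False
  have "interpolates v (Suc 0) (0 + 8 * (1 + norm (v 0) * 0) / (2 * norm (v 0)))"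
    by (rule interpolates_Suc[where u = "v 0 /\<^sub>R norm (v 0)" and \<epsilon> = 0])
      (use False in \<open>simp_all add: interpolates_0 power2_norm_eq_inner[symmetric] power2_eq_square\<close>)
  then have "least_norm_solution v 1 b (y - y')"
    unfolding One_nat_def by (rule pseudoinverse_step_least_norm) (use step in simp)
  moreover have "\<forall>j<1. v j \<bullet> 0 = b j" using b by simp
  ultimately have "norm (y - y') \<le> norm (0 :: real ^ 'n)"
    unfolding least_norm_solution_def by blast
  then show ?thesis by simp
qed

section \<open>Minimizers\<close>

lemma min_value_eq:
  assumes "p \<in> minimizers f"
  shows "min_value f = f p"
  unfolding min_value_def
  by (rule cInf_eq_minimum) (use assms in \<open>auto simp: minimizers_def is_arg_min_def not_less\<close>)

lemma min_value_le:
  assumes "p \<in> minimizers f"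
  shows "min_value f \<le> f z"
  unfolding min_value_eq[OF assms]
  using assms by (auto simp: minimizers_def is_arg_min_def not_less)

lemma minimizers_eq:
  assumes "p \<in> minimizers f"
  shows "minimizers f = {z. f z = min_value f}"
  using min_value_eq[of _ f] min_value_le[OF assms]
  by (fastforce simp: minimizers_def is_arg_min_def not_less)

lemma closed_minimizers:
  assumes "locally_lipschitz f" and p: "p \<in> minimizers f"
  shows "closed (minimizers f)"
proof -
  have "isCont f x" for x
  proof -
    obtain r K where r: "r > 0" and "K-lipschitz_on (ball x r) f"
      using assms(1) unfolding locally_lipschitz_def by blast
    then have "continuous_on (ball x r) f" by (simp add: lipschitz_on_continuous_on)
    then show ?thesis using r by (simp add: continuous_on_eq_continuous_at)
  qed
  then have "continuous_on UNIV f" by (simp add: continuous_on_eq_continuous_at)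
  then show ?thesis
    unfolding minimizers_eq[OF p]
    by (intro closed_Collect_eq) (auto intro: continuous_on_const)
qed

section \<open>Progress of the bundle steps\<close>

text \<open>The interpolation constants produced by iterating \<open>interpolates_Suc\<close> from the empty family.\<close>

primrec interp_const :: "real \<Rightarrow> real \<Rightarrow> nat \<Rightarrow> real" where
  "interp_const L \<mu> 0 = 0"
| "interp_const L \<mu> (Suc i) = interp_const L \<mu> i + 8 * (1 + L * interp_const L \<mu> i) / \<mu>"

lemma interp_const_nonneg: "0 \<le> L \<Longrightarrow> 0 < \<mu> \<Longrightarrow> 0 \<le> interp_const L \<mu> i"
  by (induction i) auto

lemma interp_const_mono:
  assumes "0 \<le> L" "0 < \<mu>" "i \<le> j"
  shows "interp_const L \<mu> i \<le> interp_const L \<mu> j"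
  using assms(3)
  by (rule lift_Suc_mono_le[rotated])
    (use assms interp_const_nonneg in \<open>simp add: add_nonneg_nonneg\<close>)

locale sharp_regular =
  fixes f :: "'a::euclidean_space \<Rightarrow> real" and g :: "'a \<Rightarrow> 'a set" and xbar :: 'a
    and \<delta> \<mu> C \<eta> L :: real
  assumes closed: "closed (minimizers f)" and xbar: "xbar \<in> minimizers f"
    and pos: "0 < \<delta>" "0 < \<mu>" "0 < C" "0 < \<eta>"
    and sharp: "sharp_at f \<mu> \<delta> xbar"
    and regular: "b_regular_at f g C \<eta> \<delta> xbar"
    and subgradient_bound: "\<And>x v. x \<in> ball xbar \<delta> \<Longrightarrow> v \<in> g x \<Longrightarrow> norm v \<le> L"
begin

abbreviation gap :: "'a \<Rightarrow> real" where
  "gap z \<equiv> f z - min_value f"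

lemma gap_nonneg: "0 \<le> gap z"
  using min_value_le[OF xbar] by simp

lemma L_nonneg: "0 \<le> L"
proof -
  obtain v where "v \<in> g xbar" using regular unfolding b_regular_at_def by blast
  then have "norm v \<le> L" using subgradient_bound[of xbar v] pos by simp
  then show ?thesis using norm_ge_zero order_trans by blast
qed

lemma sharpness: "z \<in> ball xbar \<delta> \<Longrightarrow> \<mu> * infdist z (minimizers f) \<le> gap z"
  using sharp unfolding sharp_at_def by simp

lemma regularity:
  assumes "z \<in> ball xbar \<delta>" "v \<in> g z" "p \<in> minimizers f" "p \<in> ball xbar (2 * \<delta>)"
    and "norm (p - z) \<le> r"
  shows "\<bar>gap z + v \<bullet> (p - z)\<bar> \<le> C * r powr (1 + \<eta>)"
proof -
  have "\<bar>gap z + v \<bullet> (p - z)\<bar> \<le> C * norm (p - z) powr (1 + \<eta>)"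
    using regular assms unfolding b_regular_at_def
    by (auto simp: algebra_simps)
  also have "\<dots> \<le> C * r powr (1 + \<eta>)"
    using assms(5) pos by (intro mult_left_mono powr_mono2) auto
  finally show ?thesis .
qed

lemma nearest_minimizer:
  obtains p where "p \<in> minimizers f" "infdist z (minimizers f) = norm (z - p)"
  using infdist_attains_inf[OF closed, of z] xbar by (metis dist_norm empty_iff)

text \<open>A minimizer \<open>p\<close> nearest to \<open>y 0\<close> solves the equations of the step up to the errors \<open>e j\<close>, which
  regularity bounds by \<open>C * (3 * D) powr (1 + \<eta>)\<close>. Interpolating these errors by a vector of norm at
  most \<open>D\<close> turns \<open>y 0 - p\<close> into an exact solution of norm at most \<open>2 * D\<close>, and the step is not longer.\<close>

lemma bundle_step_near:
  fixes y v :: "nat \<Rightarrow> 'a"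
  assumes y0: "norm (y 0 - xbar) < \<delta> / 4"
    and D: "D = infdist (y 0) (minimizers f)"
    and int: "interpolates v i K"
    and small: "K * (C * (3 * D) powr (1 + \<eta>)) \<le> D"
    and near: "\<And>j. j < i \<Longrightarrow> norm (y j - y 0) \<le> 2 * D"
    and vg: "\<And>j. j < i \<Longrightarrow> v j \<in> g (y j)"
    and step: "least_norm_solution v i (\<lambda>j. gap (y j) + v j \<bullet> (y 0 - y j)) (y 0 - y i)"
  shows "norm (y i - y 0) \<le> 2 * D"
proof -
  obtain p where p: "p \<in> minimizers f" "D = norm (y 0 - p)"
    unfolding D by (rule nearest_minimizer)
  have "D \<le> norm (y 0 - xbar)" unfolding D using infdist_le[OF xbar] by (simp add: dist_norm)
  then have D4: "D < \<delta> / 4" using y0 by simp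
  define e where "e j = gap (y j) + v j \<bullet> (p - y j)" for j
  have "\<bar>e j\<bar> \<le> C * (3 * D) powr (1 + \<eta>)" if j: "j < i" for j
    unfolding e_def
  proof (rule regularity)
    show "y j \<in> ball xbar \<delta>"
      using norm_triangle_ineq[of "y j - y 0" "y 0 - xbar"] near[OF j] y0 D4 pos
      by (simp add: dist_norm norm_minus_commute)
    show "p \<in> ball xbar (2 * \<delta>)"
      using norm_triangle_ineq[of "p - y 0" "y 0 - xbar"] p(2) y0 D4 pos
      by (simp add: dist_norm norm_minus_commute)
    show "norm (p - y j) \<le> 3 * D"
      using norm_triangle_ineq[of "p - y 0" "y 0 - y j"] p(2) near[OF j]
      by (simp add: norm_minus_commute)
  qed (use p vg j in auto)
  then obtain w where w: "\<And>j. j < i \<Longrightarrow> v j \<bullet> w = e j"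
    and wn: "norm w \<le> K * (C * (3 * D) powr (1 + \<eta>))"
    using interpolatesE[OF int, of "C * (3 * D) powr (1 + \<eta>)" e] pos by auto
  have "v j \<bullet> (w + (y 0 - p)) = gap (y j) + v j \<bullet> (y 0 - y j)" if "j < i" for j
    using w[OF that] by (simp add: e_def inner_add_right inner_diff_right)
  then have "norm (y 0 - y i) \<le> norm (w + (y 0 - p))"
    using step unfolding least_norm_solution_def by simp
  also have "\<dots> \<le> norm w + norm (y 0 - p)" by (rule norm_triangle_ineq)
  also have "\<dots> \<le> 2 * D" using wn small p(2) by simp
  finally show ?thesis by (simp add: norm_minus_commute)
qed

text \<open>The direction \<open>u\<close> points from the nearest minimizer \<open>p\<close> to \<open>y i\<close>. The number \<open>R\<close> stands for the
  progress that step \<open>i\<close> failed to make; it bounds \<open>d = norm (y i - p)\<close> from below through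
  \<open>gap (y i) \<le> 2 * L * d\<close>. The latter comes from regularity at \<open>y i\<close>, which reaches minimizers up to distance
  \<open>2 * \<delta>\<close> from \<open>xbar\<close>; the point \<open>p\<close> is only known to be within \<open>3 * \<delta> / 2\<close>. For \<open>i = 0\<close> the distance \<open>d\<close> is \<open>D\<close>
  itself and there are no previous vectors.\<close>

lemma new_direction:
  fixes y v :: "nat \<Rightarrow> 'a"
  assumes y0: "norm (y 0 - xbar) < \<delta> / 4"
    and D: "D = infdist (y 0) (minimizers f)" "0 < D"
    and small: "C * (3 * D) powr \<eta> \<le> \<mu> / 2"
    and near: "\<And>j. j \<le> i \<Longrightarrow> norm (y j - y 0) \<le> 2 * D"
    and vg: "\<And>j. j \<le> i \<Longrightarrow> v j \<in> g (y j)"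
    and step: "\<And>j. j < i \<Longrightarrow> v j \<bullet> (y 0 - y i) = gap (y j) + v j \<bullet> (y 0 - y j)"
    and \<epsilon>: "0 \<le> \<epsilon>" "2 * L * (C * (7 * D) powr (1 + \<eta>)) \<le> \<epsilon> * R"
    and gap: "0 < i \<Longrightarrow> 0 < gap (y i)" "0 < i \<Longrightarrow> R \<le> gap (y i)"
  shows "\<exists>u. norm u \<le> 1 \<and> \<mu> / 2 \<le> v i \<bullet> u \<and> (\<forall>j<i. \<bar>v j \<bullet> u\<bar> \<le> \<epsilon>)"
proof -
  obtain p0 where p0: "p0 \<in> minimizers f" "D = norm (y 0 - p0)"
    unfolding D(1) by (rule nearest_minimizer)
  obtain p where p: "p \<in> minimizers f" and inf: "infdist (y i) (minimizers f) = norm (y i - p)"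
    by (rule nearest_minimizer)
  define d where "d = norm (y i - p)"
  have "D \<le> norm (y 0 - xbar)" unfolding D using infdist_le[OF xbar] by (simp add: dist_norm)
  then have D4: "D < \<delta> / 4" using y0 by simp
  have ball: "norm (y j - xbar) < 3 * \<delta> / 4" if "j \<le> i" for j
    using norm_triangle_ineq[of "y j - y 0" "y 0 - xbar"] near[OF that] y0 D4 by simp
  then have ball': "y j \<in> ball xbar \<delta>" if "j \<le> i" for j
    using ball[OF that] pos by (simp add: dist_norm norm_minus_commute)
  have "d \<le> norm (y i - p0)" "d \<le> norm (y i - xbar)"
    unfolding d_def inf[symmetric] using infdist_le[OF p0(1)] infdist_le[OF xbar]
    by (simp_all add: dist_norm)
  then have d3: "d \<le> 3 * D" and dx: "d < 3 * \<delta> / 4"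
    using norm_triangle_ineq[of "y i - y 0" "y 0 - p0"] near[OF le_refl] p0(2) ball[OF le_refl] by auto
  have pball: "p \<in> ball xbar (2 * \<delta>)"
    using norm_triangle_ineq[of "p - y i" "y i - xbar"] dx ball[OF le_refl] pos
    by (simp add: dist_norm norm_minus_commute d_def)
  have dpos: "0 < d"
  proof (cases "i = 0")
    case True
    then show ?thesis using D inf by (simp add: d_def)
  next
    case False
    then have "0 < gap (y i)" using gap(1) by simp
    then have "y i \<notin> minimizers f" using min_value_eq[of "y i" f] by auto
    then have "y i \<noteq> p" using p by auto
    then show ?thesis by (simp add: d_def)
  qed
  have "C * d powr (1 + \<eta>) = d * (C * d powr \<eta>)"
    using dpos by (simp add: powr_add)
  also have "\<dots> \<le> d * (\<mu> / 2)"
    using small d3 dpos pos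
    by (intro mult_left_mono order_trans[OF _ small] powr_mono2) auto
  finally have err: "C * d powr (1 + \<eta>) \<le> \<mu> / 2 * d" by (simp add: mult.commute)
  \<comment> \<open>The regularity error is at most half of the sharpness bound \<open>\<mu> * d\<close>.\<close>
  have reg: "\<bar>gap (y i) + v i \<bullet> (p - y i)\<bar> \<le> \<mu> / 2 * d"
    by (rule order_trans[OF regularity err])
      (use ball'[OF le_refl] vg[OF le_refl] p pball in \<open>simp_all add: d_def norm_minus_commute\<close>)
  have sh: "\<mu> * d \<le> gap (y i)" using sharpness[OF ball'[OF le_refl]] inf by (simp add: d_def)
  define u where "u = (y i - p) /\<^sub>R d"
  have vu: "v j \<bullet> u = v j \<bullet> (y i - p) / d" for j by (simp add: u_def divide_inverse_commute)
  have ui: "\<mu> / 2 * d \<le> v i \<bullet> (y i - p)"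
    using reg sh unfolding inner_diff_right by linarith
  have "v i \<bullet> (y i - p) \<le> norm (v i) * d" unfolding d_def by (rule norm_cauchy_schwarz)
  also have "\<dots> \<le> L * d" using subgradient_bound[OF ball'[OF le_refl] vg[OF le_refl]] dpos by simp
  finally have viL: "v i \<bullet> (y i - p) \<le> L * d" .
  with ui have "\<mu> / 2 * d \<le> L * d" by simp
  then have gapL: "gap (y i) \<le> 2 * L * d"
    using viL reg unfolding inner_diff_right by linarith
  show ?thesis
  proof (intro exI[of _ u] conjI allI impI)
    show "norm u \<le> 1" using dpos by (simp add: u_def d_def)
    show "\<mu> / 2 \<le> v i \<bullet> u" using ui dpos by (simp add: vu field_simps)
    fix j assume j: "j < i"
    then have ji: "j \<le> i" and i: "0 < i" by simp_all
    have "v j \<bullet> (y i - p) = - (gap (y j) + v j \<bullet> (p - y j))"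
      using step[OF j] by (simp add: inner_diff_right)
    moreover have "\<bar>gap (y j) + v j \<bullet> (p - y j)\<bar> \<le> C * (7 * D) powr (1 + \<eta>)"
    proof (rule regularity)
      \<comment> \<open>Going from \<open>p\<close> via \<open>y i\<close> and \<open>y 0\<close> to \<open>y j\<close> takes at most \<open>3 * D + 2 * D + 2 * D\<close>.\<close>
      show "norm (p - y j) \<le> 7 * D"
        using norm_triangle_ineq[of "p - y i" "y i - y j"] norm_triangle_ineq[of "y i - y 0" "y 0 - y j"]
          near[OF le_refl] near[OF ji] d3 by (simp add: d_def norm_minus_commute)
    qed (use ball'[OF ji] vg[OF ji] p pball in simp_all)
    ultimately have vj: "\<bar>v j \<bullet> (y i - p)\<bar> \<le> C * (7 * D) powr (1 + \<eta>)" by simp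
    have "0 < 2 * L * d" using gapL gap(1)[OF i] by linarith
    then have Lpos: "0 < L" using dpos by (simp add: zero_less_mult_iff)
    have "2 * L * \<bar>v j \<bullet> (y i - p)\<bar> \<le> 2 * L * (C * (7 * D) powr (1 + \<eta>))"
      using vj Lpos by (intro mult_left_mono) auto
    also have "\<dots> \<le> \<epsilon> * R" by (rule \<epsilon>(2))
    also have "\<dots> \<le> \<epsilon> * (2 * L * d)" using \<epsilon>(1) gap(2)[OF i] gapL by (intro mult_left_mono) simp_all
    finally have "\<bar>v j \<bullet> (y i - p)\<bar> \<le> \<epsilon> * d" using Lpos by (simp add: mult.left_commute)
    then show "\<bar>v j \<bullet> u\<bar> \<le> \<epsilon>" using dpos by (simp add: vu field_simps)
  qed
qed

text \<open>If every step \<open>i \<ge> 1\<close> within distance \<open>2 * D\<close> had a gap above \<open>R\<close>, then by induction all steps would stay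
  within that distance and all the vectors \<open>v 0, \<dots>, v d\<close> would interpolate, one more than the dimension
  \<open>d\<close> allows.\<close>

lemma superlinear_index:
  fixes y v :: "nat \<Rightarrow> 'a"
  assumes y0: "norm (y 0 - xbar) < \<delta> / 4"
    and D: "D = infdist (y 0) (minimizers f)" "0 < D"
    and K: "K = interp_const L \<mu> DIM('a)"
    and small: "C * (3 * D) powr \<eta> \<le> \<mu> / 2" "K * (C * (3 * D) powr (1 + \<eta>)) \<le> D"
    and \<epsilon>: "0 \<le> \<epsilon>" "K * \<epsilon> \<le> 1" "L * (K * \<epsilon>) \<le> \<mu> / 4"
      "2 * L * (C * (7 * D) powr (1 + \<eta>)) \<le> \<epsilon> * R"
    and R: "0 \<le> R"
    and vg: "\<And>i. i \<le> DIM('a) \<Longrightarrow> v i \<in> g (y i)"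
    and step: "\<And>i K. 0 < i \<Longrightarrow> i \<le> DIM('a) \<Longrightarrow> interpolates v i K \<Longrightarrow>
      least_norm_solution v i (\<lambda>j. gap (y j) + v j \<bullet> (y 0 - y j)) (y 0 - y i)"
  shows "\<exists>i\<in>{1..DIM('a)}. norm (y i - y 0) \<le> 2 * D \<and> gap (y i) \<le> R"
proof (rule ccontr)
  assume no: "\<not> ?thesis"
  let ?K = "interp_const L \<mu>"
  have "interpolates v i (?K i) \<and> (\<forall>j<i. norm (y j - y 0) \<le> 2 * D)" if "i \<le> Suc DIM('a)" for i
    using that
  proof (induction i)
    case 0
    show ?case by (simp add: interpolates_0)
  next
    case (Suc i)
    then have i: "i \<le> DIM('a)" and int: "interpolates v i (?K i)"
      and near: "\<And>j. j < i \<Longrightarrow> norm (y j - y 0) \<le> 2 * D" by auto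
    have K0: "0 \<le> ?K i" using L_nonneg pos by (simp add: interp_const_nonneg)
    have Ki: "?K i \<le> K" unfolding K using L_nonneg pos i by (simp add: interp_const_mono)
    have intK: "interpolates v i K" by (rule interpolates_mono[OF int Ki])
    have lns: "least_norm_solution v i (\<lambda>j. gap (y j) + v j \<bullet> (y 0 - y j)) (y 0 - y i)" if "0 < i"
      by (rule step[OF that i int])
    have near_i: "norm (y i - y 0) \<le> 2 * D"
    proof (cases "i = 0")
      case True
      then show ?thesis using D(2) by simp
    next
      case False
      then have "least_norm_solution v i (\<lambda>j. gap (y j) + v j \<bullet> (y 0 - y j)) (y 0 - y i)"
        using lns by simp
      moreover have "v j \<in> g (y j)" if "j < i" for j using vg that i by simp
      ultimately show ?thesis
        by (intro bundle_step_near[where y = y, OF y0 D(1) intK small(2) near])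
    qed
    have near': "norm (y j - y 0) \<le> 2 * D" if "j \<le> i" for j
      using that near near_i by (cases "j = i") auto
    have gap: "R < gap (y i)" if "0 < i"
    proof (rule ccontr)
      assume "\<not> R < gap (y i)"
      then have "gap (y i) \<le> R" by simp
      moreover have "i \<in> {1..DIM('a)}" using that i by simp
      ultimately show False using no near_i by blast
    qed
    have "\<exists>u. norm u \<le> 1 \<and> \<mu> / 2 \<le> v i \<bullet> u \<and> (\<forall>j<i. \<bar>v j \<bullet> u\<bar> \<le> \<epsilon>)"
    proof (rule new_direction[where y = y and R = R, OF y0 D small(1)])
      show "v j \<bullet> (y 0 - y i) = gap (y j) + v j \<bullet> (y 0 - y j)" if "j < i" for j
        using lns that unfolding least_norm_solution_def by simp
      show "0 < gap (y i)" "R \<le> gap (y i)" if "0 < i" using gap[OF that] R by auto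
      show "v j \<in> g (y j)" if "j \<le> i" for j using vg that i by simp
    qed (fact near', rule \<epsilon>(1), rule \<epsilon>(4))
    then obtain u where u: "norm u \<le> 1" "\<mu> / 2 \<le> v i \<bullet> u" "\<And>j. j < i \<Longrightarrow> \<bar>v j \<bullet> u\<bar> \<le> \<epsilon>"
      by blast
    have "y i \<in> ball xbar \<delta>"
    proof -
      have "D \<le> norm (y 0 - xbar)" unfolding D using infdist_le[OF xbar] by (simp add: dist_norm)
      then show ?thesis
        using norm_triangle_ineq[of "y i - y 0" "y 0 - xbar"] near_i y0 pos(1)
        by (simp add: dist_norm norm_minus_commute)
    qed
    then have viL: "norm (v i) \<le> L" using subgradient_bound vg[OF i] by blast
    have "?K i * \<epsilon> \<le> K * \<epsilon>" using Ki \<epsilon>(1) by (rule mult_right_mono)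
    moreover from this have "L * (?K i * \<epsilon>) \<le> L * (K * \<epsilon>)"
      using L_nonneg by (rule mult_left_mono)
    ultimately have "interpolates v (Suc i) (?K (Suc i))"
      unfolding interp_const.simps
      by (intro interpolates_Suc[OF int K0 pos(2) viL u \<epsilon>(1)]) (use \<epsilon>(2,3) in linarith)+
    moreover have "\<forall>j<Suc i. norm (y j - y 0) \<le> 2 * D"
      using near' by (simp add: less_Suc_eq_le)
    ultimately show ?case ..
  qed
  then have "interpolates v (Suc DIM('a)) (?K (Suc DIM('a)))" by blast
  then have "Suc DIM('a) \<le> DIM('a)" by (rule interpolates_le_DIM)
  then show False by simp
qed

end

section \<open>One run of the bundle procedure\<close>

text \<open>The tolerance \<open>\<epsilon>\<close> is what \<open>interpolates_Suc\<close> needs with the constants \<open>K\<close> and \<open>L\<close>. The summands of \<open>C_s\<close> then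
  serve one requirement each: \<open>c1\<close> makes the old vectors orthogonal to the new direction up to \<open>\<epsilon>\<close>, while
  \<open>c2\<close> and \<open>c3\<close> make the neighbourhood \<open>C_s * D powr \<eta> \<le> \<kappa>\<close> so small that the regularity error is dominated
  by sharpness and the correction in a bundle step is at most \<open>D\<close>.\<close>

lemma rate_constant_exists:
  fixes \<mu> C \<eta> L K :: real
  assumes pos: "0 < \<mu>" "0 < C" "0 < \<eta>" and L: "0 \<le> L" and K: "0 \<le> K"
  obtains C_s \<epsilon> where "0 < C_s" "0 \<le> \<epsilon>" "K * \<epsilon> \<le> 1" "L * (K * \<epsilon>) \<le> \<mu> / 4"
    "\<forall>D>0. 2 * L * (C * (7 * D) powr (1 + \<eta>)) \<le> \<epsilon> * (C_s * (\<mu> * D) powr (1 + \<eta>))"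
    "\<forall>D>0. D \<le> (\<mu> powr (1 - \<eta>) / (L * C_s)) powr (1 / \<eta>) \<longrightarrow>
      C * (3 * D) powr \<eta> \<le> \<mu> / 2 \<and> K * (C * (3 * D) powr (1 + \<eta>)) \<le> D"
proof -
  define \<kappa> where "\<kappa> = \<mu> powr (1 - \<eta>) / L"
  define \<epsilon> where "\<epsilon> = min (1 / (K + 1)) (\<mu> / (4 * (L * K + 1)))"
  define c1 where "c1 = 2 * L * C * 7 powr (1 + \<eta>) / (\<epsilon> * \<mu> powr (1 + \<eta>))"
  define c2 where "c2 = 2 * \<kappa> * C * 3 powr \<eta> / \<mu>"
  define c3 where "c3 = \<kappa> * K * C * 3 powr (1 + \<eta>)"
  define C_s where "C_s = 1 + c1 + c2 + c3"
  have \<epsilon>: "0 < \<epsilon>" using pos L K by (simp add: \<epsilon>_def add_nonneg_pos)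
  have \<kappa>: "0 \<le> \<kappa>" using L by (simp add: \<kappa>_def)
  have c: "0 \<le> c1" "0 \<le> c2" "0 \<le> c3"
    using \<epsilon> \<kappa> pos L K by (simp_all add: c1_def c2_def c3_def)
  have C_s: "0 < C_s" using c by (simp add: C_s_def)
  show ?thesis
  proof (rule that[OF C_s less_imp_le[OF \<epsilon>]]; (intro allI impI)?)
    have "K * \<epsilon> \<le> K * (1 / (K + 1))" using K by (intro mult_left_mono) (simp_all add: \<epsilon>_def)
    also have "\<dots> \<le> 1" using K by simp
    finally show "K * \<epsilon> \<le> 1" .
    have "L * K * \<epsilon> \<le> L * K * (\<mu> / (4 * (L * K + 1)))"
      using L K by (intro mult_left_mono) (simp_all add: \<epsilon>_def)
    also have "\<dots> = \<mu> / 4 * (L * K / (L * K + 1))" by simp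
    also have "\<dots> \<le> \<mu> / 4 * 1"
      using pos mult_nonneg_nonneg[OF L K] by (intro mult_left_mono) (simp_all add: divide_le_eq_1)
    finally show "L * (K * \<epsilon>) \<le> \<mu> / 4" by (simp add: mult.assoc)
  next
    fix D :: real assume D: "0 < D"
    have "2 * L * (C * (7 * D) powr (1 + \<eta>)) = \<epsilon> * (c1 * (\<mu> * D) powr (1 + \<eta>))"
      using \<epsilon> pos D by (simp add: c1_def powr_mult)
    also have "\<dots> \<le> \<epsilon> * (C_s * (\<mu> * D) powr (1 + \<eta>))"
      using c \<epsilon> by (intro mult_left_mono mult_right_mono) (auto simp: C_s_def)
    finally show "2 * L * (C * (7 * D) powr (1 + \<eta>)) \<le> \<epsilon> * (C_s * (\<mu> * D) powr (1 + \<eta>))" .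
    assume "D \<le> (\<mu> powr (1 - \<eta>) / (L * C_s)) powr (1 / \<eta>)"
    then have "D \<le> (\<kappa> / C_s) powr (1 / \<eta>)" by (simp add: \<kappa>_def)
    then have "D powr \<eta> \<le> ((\<kappa> / C_s) powr (1 / \<eta>)) powr \<eta>"
      using D pos by (intro powr_mono2) auto
    also have "\<dots> = \<kappa> / C_s" using pos \<kappa> C_s by (simp add: powr_powr)
    finally have "C_s * D powr \<eta> \<le> \<kappa>" using C_s by (simp add: field_simps)
    then have D\<eta>: "c * D powr \<eta> \<le> \<kappa>" if "c \<le> C_s" for c
      using that by (meson mult_right_mono order_trans powr_ge_zero)
    have Dp: "0 < D powr \<eta>" using D by simp
    show "C * (3 * D) powr \<eta> \<le> \<mu> / 2 \<and> K * (C * (3 * D) powr (1 + \<eta>)) \<le> D"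
    \<comment> \<open>For \<open>L = 0\<close> the quotient \<open>\<kappa>\<close> takes the default value \<open>0\<close>, which excludes every \<open>D > 0\<close>.\<close>
    proof (cases "\<kappa> = 0")
      case True
      then have "C_s * D powr \<eta> \<le> 0" using \<open>C_s * D powr \<eta> \<le> \<kappa>\<close> by simp
      then have False using C_s Dp by (simp add: mult_le_0_iff)
      then show ?thesis ..
    next
      case False
      then have \<kappa>pos: "0 < \<kappa>" using \<kappa> by simp
      have "c2 * D powr \<eta> \<le> \<kappa>" by (rule D\<eta>) (use c in \<open>simp add: C_s_def\<close>)
      then have "\<kappa> * (2 / \<mu> * (C * 3 powr \<eta> * D powr \<eta>)) \<le> \<kappa> * 1" by (simp add: c2_def mult_ac)
      then have "2 / \<mu> * (C * 3 powr \<eta> * D powr \<eta>) \<le> 1" using \<kappa>pos by (simp only: mult_le_cancel_left_pos)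
      then have 1: "C * (3 * D) powr \<eta> \<le> \<mu> / 2" using pos D by (simp add: powr_mult field_simps)
      have "c3 * D powr \<eta> \<le> \<kappa>" by (rule D\<eta>) (use c in \<open>simp add: C_s_def\<close>)
      then have "\<kappa> * (K * C * 3 powr (1 + \<eta>) * D powr \<eta>) \<le> \<kappa> * 1" by (simp add: c3_def mult_ac)
      then have "K * C * 3 powr (1 + \<eta>) * D powr \<eta> \<le> 1" using \<kappa>pos by (simp only: mult_le_cancel_left_pos)
      then have "D * (K * C * 3 powr (1 + \<eta>) * D powr \<eta>) \<le> D * 1" using D by (intro mult_left_mono) auto
      then have "K * (C * (3 * D) powr (1 + \<eta>)) \<le> D"
        using D by (simp add: powr_mult powr_add mult_ac)
      with 1 show ?thesis ..
    qed
  qed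
qed

lemma polyak_bundle_output:
  assumes "out \<in> polyak_bundle f g x \<tau>"
    and "\<And>y v. bundle_iterates f g x y v \<Longrightarrow> \<exists>i\<in>bundle_candidates f \<tau> y. f (y i) \<le> b"
  shows "\<exists>xt. out = Some xt \<and> f xt \<le> b"
proof -
  obtain y v where run: "bundle_iterates f g x y v"
    and out: "if bundle_candidates f \<tau> y = {} then out = None
      else \<exists>s. is_arg_min (\<lambda>i. f (y i)) (\<lambda>i. i \<in> bundle_candidates f \<tau> y) s \<and> out = Some (y s)"
    using assms(1) unfolding polyak_bundle_def by blast
  obtain i where i: "i \<in> bundle_candidates f \<tau> y" "f (y i) \<le> b" using assms(2)[OF run] by blast
  then obtain s where "is_arg_min (\<lambda>i. f (y i)) (\<lambda>i. i \<in> bundle_candidates f \<tau> y) s"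
    and "out = Some (y s)" using out by (auto split: if_splits)
  then show ?thesis using i by (force simp: is_arg_min_def not_less)
qed

lemma bundle_iterates_least_norm:
  fixes v :: "nat \<Rightarrow> real ^ 'n"
  assumes "bundle_iterates f g x y v" "0 < i" "i \<le> CARD('n)" "interpolates v i K"
  shows "least_norm_solution v i (\<lambda>j. f (y j) - min_value f + v j \<bullet> (y 0 - y j)) (y 0 - y i)"
  by (rule pseudoinverse_step_least_norm[OF assms(4)])
    (use assms in \<open>auto simp: bundle_iterates_def bundle_residual_def Suc_le_eq\<close>)

theorem theorem2p2:
  fixes f :: "real ^ 'n \<Rightarrow> real"
    and g :: "real ^ 'n \<Rightarrow> (real ^ 'n) set"
    and xbar :: "real ^ 'n"
    and \<delta> \<mu> C_b \<eta> L :: real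
  assumes "locally_lipschitz f"
    and "minimizers f \<noteq> {}"
    and "xbar \<in> minimizers f"
    and "\<delta> > 0" and "\<mu> > 0" and "C_b > 0" and "\<eta> > 0"
    and "sharp_at f \<mu> \<delta> xbar"
    and "b_regular_at f g C_b \<eta> \<delta> xbar"
    and "\<forall>v \<in> (\<Union>x\<in>ball xbar \<delta>. g x). norm v \<le> L"
    and "L-lipschitz_on (ball xbar \<delta>) f"
  shows "\<exists>C_s>0. \<forall>\<tau>>3 / \<mu>. \<forall>x.
    norm (x - xbar) < \<delta> / 4 \<longrightarrow>
    infdist x (minimizers f) \<le>
      min ((\<mu> / (2 * C_b)) powr (1 / \<eta>)) ((\<mu> powr (1 - \<eta>) / (L * C_s)) powr (1 / \<eta>)) \<longrightarrow>
    (\<forall>out \<in> polyak_bundle f g x \<tau>. \<exists>xt. out = Some xt \<and>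
       f xt - min_value f \<le> C_s * (f x - min_value f) powr (1 + \<eta>))"
proof -
  interpret sharp_regular f g xbar \<delta> \<mu> C_b \<eta> L
    by unfold_locales (use assms closed_minimizers in auto)
  define K where "K = interp_const L \<mu> CARD('n)"
  have K: "0 \<le> K" unfolding K_def using L_nonneg pos(2) by (rule interp_const_nonneg)
  obtain C_s \<epsilon> where C_s: "0 < C_s" and \<epsilon>: "0 \<le> \<epsilon>" "K * \<epsilon> \<le> 1" "L * (K * \<epsilon>) \<le> \<mu> / 4"
    and dir: "\<forall>D>0.
      2 * L * (C_b * (7 * D) powr (1 + \<eta>)) \<le> \<epsilon> * (C_s * (\<mu> * D) powr (1 + \<eta>))"
    and small: "\<forall>D>0. D \<le> (\<mu> powr (1 - \<eta>) / (L * C_s)) powr (1 / \<eta>) \<longrightarrow>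
      C_b * (3 * D) powr \<eta> \<le> \<mu> / 2 \<and> K * (C_b * (3 * D) powr (1 + \<eta>)) \<le> D"
    by (rule rate_constant_exists[OF pos(2-4) L_nonneg K])
  show ?thesis
  proof (intro exI[of _ C_s] conjI allI impI ballI)
    fix \<tau> x out
    assume \<tau>: "3 / \<mu> < \<tau>" and x: "norm (x - xbar) < \<delta> / 4"
      and Dx: "infdist x (minimizers f) \<le>
        min ((\<mu> / (2 * C_b)) powr (1 / \<eta>)) ((\<mu> powr (1 - \<eta>) / (L * C_s)) powr (1 / \<eta>))"
      and out: "out \<in> polyak_bundle f g x \<tau>"
    define D where "D = infdist x (minimizers f)"
    define R where "R = C_s * gap x powr (1 + \<eta>)"
    have R: "0 \<le> R" using C_s by (simp add: R_def)
    have gapx: "\<mu> * D \<le> gap x"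
      unfolding D_def by (rule sharpness) (use x pos in \<open>simp add: dist_norm norm_minus_commute\<close>)
    have "\<exists>i\<in>bundle_candidates f \<tau> y. f (y i) \<le> min_value f + R"
      if run: "bundle_iterates f g x y v" for y v
    proof (cases "D = 0")
      case True
      then have "x \<in> minimizers f"
        using in_closed_iff_infdist_zero[OF closed] xbar by (auto simp: D_def)
      then have x0: "f x = min_value f" by (simp add: min_value_eq)
      have y0: "y 0 = x" using run by (simp add: bundle_iterates_def)
      \<comment> \<open>The iterates after \<open>y 1\<close> are arbitrary here, but \<open>y 1\<close> alone is already a candidate with minimal value.\<close>
      have "y 1 = y 0"
        by (rule first_bundle_step_zero_residual
            [where b = "\<lambda>j. f (y j) - min_value f + v j \<bullet> (y 0 - y j)" and v = v])
          (use run x0 y0 in \<open>auto simp: bundle_iterates_def bundle_residual_def Suc_le_eq\<close>)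
      then show ?thesis
        using x0 y0 R by (intro bexI[of _ 1]) (auto simp: bundle_candidates_def Suc_le_eq)
    next
      case False
      then have D: "0 < D" using infdist_nonneg[of x] by (simp add: D_def less_le)
      have y0: "y 0 = x" using run by (simp add: bundle_iterates_def)
      have "(\<mu> * D) powr (1 + \<eta>) \<le> gap x powr (1 + \<eta>)"
        using gapx D pos by (intro powr_mono2) auto
      then have "\<epsilon> * (C_s * (\<mu> * D) powr (1 + \<eta>)) \<le> \<epsilon> * R"
        unfolding R_def using \<epsilon>(1) C_s by (intro mult_left_mono) auto
      then have dirR: "2 * L * (C_b * (7 * D) powr (1 + \<eta>)) \<le> \<epsilon> * R"
        using dir D by fastforce
      have vg: "v i \<in> g (y i)" if "i \<le> CARD('n)" for i
        using run that by (cases "i = 0") (auto simp: bundle_iterates_def Suc_le_eq)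
      have "\<exists>i\<in>{1..DIM(real ^ 'n)}. norm (y i - y 0) \<le> 2 * D \<and> gap (y i) \<le> R"
      proof (rule superlinear_index[where D = D and K = K and \<epsilon> = \<epsilon> and v = v])
        show "C_b * (3 * D) powr \<eta> \<le> \<mu> / 2" "K * (C_b * (3 * D) powr (1 + \<eta>)) \<le> D"
          using small D Dx by (simp_all add: D_def)
        show "least_norm_solution v i (\<lambda>j. gap (y j) + v j \<bullet> (y 0 - y j)) (y 0 - y i)"
          if "0 < i" "i \<le> DIM(real ^ 'n)" "interpolates v i K'" for i K'
          using that by (intro bundle_iterates_least_norm[OF run]) auto
      qed (use x y0 D \<epsilon> dirR R vg in \<open>simp_all add: D_def K_def\<close>)
      then obtain i where i: "i \<in> {1..CARD('n)}" "norm (y i - y 0) \<le> 2 * D" "gap (y i) \<le> R"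
        by auto
      have "2 * D \<le> 3 / \<mu> * (\<mu> * D)" using D pos by simp
      also have "\<dots> \<le> \<tau> * gap x"
        using \<tau> gapx D pos by (intro mult_mono) (auto intro: order_trans[of _ "3 / \<mu>"])
      finally have "i \<in> bundle_candidates f \<tau> y"
        using i y0 by (simp add: bundle_candidates_def)
      then show ?thesis using i(3) by (intro bexI[of _ i]) simp_all
    qed
    then have "\<exists>xt. out = Some xt \<and> f xt \<le> min_value f + R"
      by (rule polyak_bundle_output[OF out])
    then show "\<exists>xt. out = Some xt \<and>
        f xt - min_value f \<le> C_s * (f x - min_value f) powr (1 + \<eta>)"
      by (auto simp: R_def)
  qed (rule C_s)
qed

end
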